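(* Let $G=(V,E,w)$ be a finite connected weighted graph with symmetric edge set and symmetric weight function $w:E\to\mathbb{R}_{\ge 0}$, let $\Gamma\subset V$, and let $d$ be the distance function to $\Gamma$. Then for all $x\in V$ and $y\sim x$, $$|(\nabla_w d)(x,y)|\begin{cases}=1, & \text{if } y\in\mathrm{SP}(x,\Gamma)\text{ or }x\in\mathrm{SP}(y,\Gamma),\\ <1, & \text{else,}\end{cases}$$ where $$\mathrm{SP}(x,\Gamma)=\left\{x_0\sim\dots\sim x_n:\ x_0=x,\ x_n\in\Gamma,\ d(x)=\sum_{i=1}^n w(x_{i-1},x_i)^{-1/2}\right\}$$ denotes the set of all shortest paths from $x$ to $\Gamma$, and $y\in\mathrm{SP}(x,\Gamma)$ means that the vertex $y$ lies on such a shortest path.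
   Context: $V$ is a finite vertex set, $E\subset V\times V$ the edge set, $x\sim y$ means $(x,y)\in E$; symmetry means $x\sim y\iff y\sim x$ and $w(x,y)=w(y,x)$ if $x\sim y$. Connected means that any two vertices are joined by a finite sequence of consecutive edges. For $u:V\to\mathbb{R}$ the weighted gradient is $(\nabla_w u)(x,y)=w(x,y)^{1/2}(u(y)-u(x))$ for $(x,y)\in E$. The graph distance of $x,y\in V$ is $d_w(x,y)=\min\{\sum_{i=1}^n w(x_{i-1},x_i)^{-1/2}: n\in\mathbb{N},\ x_0\sim\dots\sim x_n,\ x_0=x,\ x_n=y\}$, and the distance function to $\Gamma$ is $d(x)=\min_{y\in\Gamma}d_w(x,y)$ for $x\in V$.
   Formalization: "y ∈ SP(x,Γ)" is read as: a shortest path from x to Γ traverses the edge from x to y (x, y consecutive); if y may lie anywhere on the path, the "= 1" case fails. Γ is taken nonempty and d finite. *)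

theory Defs
  imports Complex_Main "HOL-Library.Extended_Real"
begin

(* The weighted graph is given by V :: 'a set, E :: ('a * 'a) set and w :: 'a => 'a => real, of
   which only the values on E are meaningful. A path x_0 ~ ... ~ x_n is the list [x_0, ..., x_n];
   n = 0 is allowed, so that the distance from a vertex to itself is 0. *)

definition paths :: "('a \<times> 'a) set \<Rightarrow> 'a list set" where
  "paths E = {p. p \<noteq> [] \<and> successively (\<lambda>u v. (u, v) \<in> E) p}"

(* w(x,y)^(-1/2). Weights may vanish on edges; in ereal, inverse 0 = \<infinity>, so such edges have
   infinite length. *)
definition edge_length :: "('a \<Rightarrow> 'a \<Rightarrow> real) \<Rightarrow> 'a \<Rightarrow> 'a \<Rightarrow> ereal" where
  "edge_length w x y = inverse (ereal (sqrt (w x y)))"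

definition path_length :: "('a \<Rightarrow> 'a \<Rightarrow> real) \<Rightarrow> 'a list \<Rightarrow> ereal" where
  "path_length w p = (\<Sum>i = 1..<length p. edge_length w (p ! (i - 1)) (p ! i))"

(* The infimum is a minimum on a finite connected graph with nonnegative weights. *)
definition graph_dist :: "('a \<times> 'a) set \<Rightarrow> ('a \<Rightarrow> 'a \<Rightarrow> real) \<Rightarrow> 'a \<Rightarrow> 'a \<Rightarrow> ereal" where
  "graph_dist E w x y = (INF p \<in> {p \<in> paths E. hd p = x \<and> last p = y}. path_length w p)"

definition dist_to :: "('a \<times> 'a) set \<Rightarrow> ('a \<Rightarrow> 'a \<Rightarrow> real) \<Rightarrow> 'a set \<Rightarrow> 'a \<Rightarrow> ereal" where
  "dist_to E w \<Gamma> x = Min (graph_dist E w x ` \<Gamma>)"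

definition weighted_gradient :: "('a \<Rightarrow> 'a \<Rightarrow> real) \<Rightarrow> ('a \<Rightarrow> real) \<Rightarrow> 'a \<Rightarrow> 'a \<Rightarrow> real" where
  "weighted_gradient w u x y = sqrt (w x y) * (u y - u x)"

definition SP :: "('a \<times> 'a) set \<Rightarrow> ('a \<Rightarrow> 'a \<Rightarrow> real) \<Rightarrow> 'a set \<Rightarrow> 'a \<Rightarrow> 'a list set" where
  "SP E w \<Gamma> x =
     {p \<in> paths E. hd p = x \<and> last p \<in> \<Gamma> \<and> dist_to E w \<Gamma> x = path_length w p}"

(* "y \<in> SP(x, \<Gamma>)" for a neighbour y of x: y lies on a shortest path from x to \<Gamma> that reaches y
   from x along the edge (x, y). It would not suffice that y occurs somewhere on a shortest path:
   if \<Gamma> = {y} and x ~ z ~ y is shorter than the edge x ~ y, then y lies on a shortest path from x,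
   but the gradient of the distance along (x, y) has modulus less than 1. *)
definition lies_on_SP ::
  "('a \<times> 'a) set \<Rightarrow> ('a \<Rightarrow> 'a \<Rightarrow> real) \<Rightarrow> 'a set \<Rightarrow> 'a \<Rightarrow> 'a \<Rightarrow> bool" where
  "lies_on_SP E w \<Gamma> y x \<longleftrightarrow>
     (\<exists>p \<in> SP E w \<Gamma> x. \<exists>i. Suc i < length p \<and> p ! i = x \<and> p ! Suc i = y)"

end

theory Submission
  imports Defs
begin

text \<open>Prepending an edge to a path gives the triangle inequality
  \<open>d x \<le> edge_length w x y + d y\<close>, so \<open>\<bar>\<nabla> d\<bar> \<le> 1\<close> along \<open>(x, y)\<close>. Equality
  \<open>d x = edge_length w x y + d y\<close> holds precisely when prepending \<open>x\<close> to a shortest path from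
  \<open>y\<close> gives a shortest path from \<open>x\<close>. Shortest paths exist because cutting out cycles reduces
  the infimum to the finitely many paths without repeated vertices.\<close>

section \<open>Recursion and decomposition for paths and their lengths\<close>

lemma path_length_singleton [simp]: "path_length w [x] = 0"
  by (simp add: path_length_def)

lemma path_length_Cons_Cons [simp]:
  "path_length w (x # y # p) = edge_length w x y + path_length w (y # p)"
proof -
  let ?q = "x # y # p"
  have "path_length w ?q =
      edge_length w (?q ! 0) (?q ! 1) + (\<Sum>i = 2..<length ?q. edge_length w (?q ! (i - 1)) (?q ! i))"
    unfolding path_length_def
    by (subst sum.atLeast_Suc_lessThan) (auto simp: numeral_2_eq_2)
  \<comment> \<open>Index \<open>i\<close> stands for the edge ending at entry \<open>i\<close>, so
    removing the head \<open>x\<close> lowers every index by one.\<close>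
  also have "(\<Sum>i = 2..<length ?q. edge_length w (?q ! (i - 1)) (?q ! i)) =
      (\<Sum>i = 1..<length (y # p). edge_length w (?q ! (Suc i - 1)) (?q ! Suc i))"
    using sum.shift_bounds_Suc_ivl
      [of "\<lambda>i. edge_length w (?q ! (i - 1)) (?q ! i)" 1 "length (y # p)"]
    by (simp add: numeral_2_eq_2)
  also have "\<dots> = path_length w (y # p)"
    unfolding path_length_def by (intro sum.cong) (auto simp: nth_Cons')
  finally show ?thesis by simp
qed

text \<open>The cut vertex \<open>x\<close> ends the first piece and starts the second, so each edge
  is counted exactly once.\<close>

lemma path_length_append:
  "path_length w (p @ x # q) = path_length w (p @ [x]) + path_length w (x # q)"
proof (induction p)
  case (Cons a p)
  then show ?case by (cases p) (auto simp: add.assoc)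
qed simp

lemma paths_singleton [simp]: "[x] \<in> paths E"
  by (simp add: paths_def)

lemma paths_Cons_Cons [simp]: "x # y # p \<in> paths E \<longleftrightarrow> (x, y) \<in> E \<and> y # p \<in> paths E"
  by (simp add: paths_def)

lemma paths_append: "p @ x # q \<in> paths E \<longleftrightarrow> p @ [x] \<in> paths E \<and> x # q \<in> paths E"
proof (induction p)
  case (Cons a p)
  then show ?case by (cases p) auto
qed simp

lemma paths_ConsE:
  assumes "p \<in> paths E" and "hd p = x"
  obtains q where "p = x # q"
  using assms by (cases p) (auto simp: paths_def)

text \<open>A singleton list is a path at every element of the type, hence the condition on
  \<open>hd p\<close>; later vertices are endpoints of edges.\<close>

lemma set_path_subset:
  assumes "E \<subseteq> V \<times> V" and "p \<in> paths E" and "hd p \<in> V"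
  shows "set p \<subseteq> V"
  using assms(2,3)
proof (induction p rule: induct_list012)
  case (3 x y p)
  with assms(1) show ?case by auto
qed auto

lemma rtrancl_imp_path:
  assumes "(x, y) \<in> E\<^sup>*"
  shows "\<exists>p \<in> paths E. hd p = x \<and> last p = y"
  using assms
proof (induction rule: converse_rtrancl_induct)
  case base
  show ?case by (rule bexI[of _ "[y]"]) auto
next
  case (step x z)
  then obtain p where p: "p \<in> paths E" "hd p = z" "last p = y" by blast
  obtain q where "p = z # q" using p(1,2) by (rule paths_ConsE)
  with p step.hyps show ?case by (intro bexI[of _ "x # p"]) auto
qed

section \<open>Nonnegative lengths and existence of minimal paths\<close>

lemma edge_length_nonneg: "w x y \<ge> 0 \<Longrightarrow> edge_length w x y \<ge> 0"
  by (simp add: edge_length_def)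

lemma edge_length_eq_ereal: "w x y > 0 \<Longrightarrow> edge_length w x y = ereal (1 / sqrt (w x y))"
  by (simp add: edge_length_def field_simps)

lemma path_length_nonneg:
  assumes "\<And>x y. (x, y) \<in> E \<Longrightarrow> w x y \<ge> 0" and "p \<in> paths E"
  shows "path_length w p \<ge> 0"
  using assms(2)
proof (induction p rule: induct_list012)
  case 1
  then show ?case by (simp add: paths_def)
next
  case (3 x y p)
  with assms(1) show ?case by (simp add: edge_length_nonneg)
qed simp

text \<open>Between two occurrences of a vertex \<open>a\<close> the path runs through a closed walk
  of nonnegative length. Deleting it keeps both endpoints and shortens the list, so induction on the
  number of entries applies.\<close>

lemma exists_distinct_path:
  assumes w_nonneg: "\<And>x y. (x, y) \<in> E \<Longrightarrow> w x y \<ge> 0" and "p \<in> paths E"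
  shows "\<exists>q \<in> paths E. distinct q \<and> hd q = hd p \<and> last q = last p
    \<and> path_length w q \<le> path_length w p"
  using assms(2)
proof (induction p rule: length_induct)
  case (1 p)
  show ?case
  proof (cases "distinct p")
    case True
    with 1 show ?thesis by blast
  next
    case False
    then obtain xs ys zs a where p: "p = xs @ [a] @ ys @ [a] @ zs"
      using not_distinct_decomp by blast
    let ?q = "xs @ a # zs"
    have parts: "xs @ [a] \<in> paths E" "a # ys @ [a] \<in> paths E" "a # zs \<in> paths E"
      using "1.prems" paths_append[of xs a "ys @ a # zs"] paths_append[of "a # ys" a zs]
      by (simp_all add: p)
    then have q: "?q \<in> paths E"
      using paths_append[of xs a zs] by simp
    have "path_length w p =
        path_length w (xs @ [a]) + (path_length w (a # ys @ [a]) + path_length w (a # zs))"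
      using path_length_append[of w xs a "ys @ a # zs"] path_length_append[of w "a # ys" a zs]
      by (simp add: p)
    moreover have "path_length w (a # ys @ [a]) \<ge> 0"
      using w_nonneg parts(2) by (rule path_length_nonneg)
    ultimately have "path_length w ?q \<le> path_length w p"
      using path_length_append[of w xs a zs]
        add_right_mono[of 0 "path_length w (a # ys @ [a])" "path_length w (a # zs)"]
      by (simp add: add_left_mono)
    moreover have "length ?q < length p" "hd ?q = hd p" "last ?q = last p"
      by (simp_all add: p hd_append)
    ultimately show ?thesis
      using "1.IH" q by (metis order_trans)
  qed
qed

lemma graph_dist_le:
  assumes "p \<in> paths E" and "hd p = x" and "last p = y"
  shows "graph_dist E w x y \<le> path_length w p"
  unfolding graph_dist_def using assms by (intro INF_lower) auto

text \<open>The infimum ranges over possibly infinitely many paths, but each is dominated by a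
  repetition-free one, and a finite \<open>V\<close> carries only finitely many of those.\<close>

lemma graph_dist_attained:
  assumes "finite V" and "E \<subseteq> V \<times> V" and "x \<in> V" and "(x, y) \<in> E\<^sup>*"
    and w_nonneg: "\<And>x y. (x, y) \<in> E \<Longrightarrow> w x y \<ge> 0"
  shows "\<exists>p \<in> paths E. hd p = x \<and> last p = y \<and> graph_dist E w x y = path_length w p"
proof -
  define D where "D = {p \<in> paths E. distinct p \<and> hd p = x \<and> last p = y}"
  have "D \<subseteq> {p. set p \<subseteq> V \<and> distinct p}"
    using set_path_subset[OF assms(2)] assms(3) by (auto simp: D_def)
  then have "finite D"
    using finite_subset_distinct[OF assms(1)] finite_subset by blast
  moreover have D_below: "\<exists>q \<in> D. path_length w q \<le> path_length w p"
    if "p \<in> paths E" "hd p = x" "last p = y" for p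
    using exists_distinct_path[of E w p, OF w_nonneg that(1)] that(2,3) by (auto simp: D_def)
  moreover have "D \<noteq> {}"
    using rtrancl_imp_path[OF assms(4)] D_below by blast
  \<comment> \<open>A minimal element of the finite set of lengths is a least one, since
    \<open>ereal\<close> is linearly ordered.\<close>
  ultimately obtain p where p: "p \<in> D" "\<And>q. q \<in> D \<Longrightarrow> path_length w p \<le> path_length w q"
    using ex_min_if_finite[of "path_length w ` D"] by (auto simp: not_less)
  have "graph_dist E w x y = path_length w p"
  proof (rule antisym)
    show "graph_dist E w x y \<le> path_length w p"
      using p(1) by (intro graph_dist_le) (auto simp: D_def)
    show "path_length w p \<le> graph_dist E w x y"
      unfolding graph_dist_def using D_below p(2)
      by (intro INF_greatest) (blast intro: order_trans)
  qed
  with p(1) show ?thesis by (auto simp: D_def)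
qed

section \<open>Distance to \<open>\<Gamma>\<close> and its shortest paths\<close>

lemma dist_to_le:
  assumes "finite \<Gamma>" and "p \<in> paths E" and "hd p = x" and "last p \<in> \<Gamma>"
  shows "dist_to E w \<Gamma> x \<le> path_length w p"
proof -
  have "dist_to E w \<Gamma> x \<le> graph_dist E w x (last p)"
    unfolding dist_to_def using assms by (intro Min_le) auto
  also have "\<dots> \<le> path_length w p"
    using assms by (intro graph_dist_le) auto
  finally show ?thesis .
qed

text \<open>Two minima are attained in turn: over the target in \<open>\<Gamma>\<close>, then over
  the paths to that target.\<close>

lemma SP_nonempty:
  assumes "finite V" and "E \<subseteq> V \<times> V" and "x \<in> V"
    and "finite \<Gamma>" and "\<Gamma> \<noteq> {}" and "\<And>y. y \<in> \<Gamma> \<Longrightarrow> (x, y) \<in> E\<^sup>*"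
    and "\<And>x y. (x, y) \<in> E \<Longrightarrow> w x y \<ge> 0"
  shows "SP E w \<Gamma> x \<noteq> {}"
proof -
  have "dist_to E w \<Gamma> x \<in> graph_dist E w x ` \<Gamma>"
    unfolding dist_to_def using assms(4,5) by (intro Min_in) auto
  then obtain y where y: "y \<in> \<Gamma>" "dist_to E w \<Gamma> x = graph_dist E w x y" by blast
  with graph_dist_attained[of V E x y w, OF assms(1-3) assms(6)[OF y(1)] assms(7)]
  show ?thesis by (auto simp: SP_def)
qed

lemma dist_to_triangle:
  assumes "finite \<Gamma>" and "(x, y) \<in> E" and "SP E w \<Gamma> y \<noteq> {}"
  shows "dist_to E w \<Gamma> x \<le> edge_length w x y + dist_to E w \<Gamma> y"
proof -
  from assms(3) obtain p where p: "p \<in> paths E" "hd p = y" "last p \<in> \<Gamma>"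
    "dist_to E w \<Gamma> y = path_length w p"
    by (auto simp: SP_def)
  obtain q where "p = y # q" using p(1,2) by (rule paths_ConsE)
  with p assms(1,2) dist_to_le[of \<Gamma> "x # p" E x w] show ?thesis by simp
qed

text \<open>This is the equality case of \<open>dist_to_triangle\<close>. The forward direction
  proves the opposite inequality instead of cancelling lengths, since cancellation can fail at
  infinity in \<open>ereal\<close>.\<close>

lemma lies_on_SP_iff:
  assumes "finite \<Gamma>" and "(x, y) \<in> E" and "SP E w \<Gamma> y \<noteq> {}"
    and w_nonneg: "\<And>x y. (x, y) \<in> E \<Longrightarrow> w x y \<ge> 0"
  shows "lies_on_SP E w \<Gamma> y x \<longleftrightarrow> dist_to E w \<Gamma> x = edge_length w x y + dist_to E w \<Gamma> y"
proof
  assume "lies_on_SP E w \<Gamma> y x"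
  then obtain p i where p: "p \<in> paths E" "last p \<in> \<Gamma>" "dist_to E w \<Gamma> x = path_length w p"
    and i: "Suc i < length p" "p ! i = x" "p ! Suc i = y"
    by (auto simp: lies_on_SP_def SP_def)
  define q where "q = drop (Suc (Suc i)) p"
  \<comment> \<open>The edge from \<open>x\<close> to \<open>y\<close> may occur at any position
    \<open>i\<close>; what precedes it is a walk from \<open>x\<close> back to \<open>x\<close>,
    which is dropped below because its length is nonnegative.\<close>
  have split: "p = take i p @ x # y # q"
    using i id_take_nth_drop[of i p] Cons_nth_drop_Suc[of "Suc i" p] by (simp add: q_def)
  have parts: "take i p @ [x] \<in> paths E" "y # q \<in> paths E"
    using p(1) paths_append[of "take i p" x "y # q"] split by auto
  have "last (y # q) \<in> \<Gamma>"
    using p(2) split by (metis last_ConsR last_appendR list.distinct(1))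
  with parts(2) assms(1) have "dist_to E w \<Gamma> y \<le> path_length w (y # q)"
    by (intro dist_to_le) auto
  then have "edge_length w x y + dist_to E w \<Gamma> y \<le> path_length w (x # y # q)"
    by (simp add: add_left_mono)
  also have "\<dots> \<le> path_length w (take i p @ [x]) + path_length w (x # y # q)"
    using path_length_nonneg[of E w, OF w_nonneg parts(1)] add_right_mono by fastforce
  also have "\<dots> = dist_to E w \<Gamma> x"
    using p(3) split path_length_append by metis
  finally show "dist_to E w \<Gamma> x = edge_length w x y + dist_to E w \<Gamma> y"
    using dist_to_triangle[OF assms(1-3)] by simp
next
  assume eq: "dist_to E w \<Gamma> x = edge_length w x y + dist_to E w \<Gamma> y"
  from assms(3) obtain p where p: "p \<in> SP E w \<Gamma> y" by blast
  then obtain q where q: "p = y # q"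
    by (auto simp: SP_def elim: paths_ConsE)
  have "x # p \<in> SP E w \<Gamma> x"
    using p q eq assms(2) by (simp add: SP_def)
  then show "lies_on_SP E w \<Gamma> y x"
    unfolding lies_on_SP_def using q by (intro bexI[of _ "x # p"] exI[of _ 0]) auto
qed

theorem proposition5p3:
  fixes V \<Gamma> :: "'a set" and E :: "('a \<times> 'a) set" and w :: "'a \<Rightarrow> 'a \<Rightarrow> real"
    and d :: "'a \<Rightarrow> real"
  assumes "finite V" and "E \<subseteq> V \<times> V"
    and E_sym: "\<And>x y. (x, y) \<in> E \<longleftrightarrow> (y, x) \<in> E"
    and w_sym: "\<And>x y. (x, y) \<in> E \<Longrightarrow> w x y = w y x"
    and w_nonneg: "\<And>x y. (x, y) \<in> E \<Longrightarrow> w x y \<ge> 0"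
    and connected: "\<And>x y. x \<in> V \<Longrightarrow> y \<in> V \<Longrightarrow> (x, y) \<in> E\<^sup>*"
    and "\<Gamma> \<subseteq> V" and "\<Gamma> \<noteq> {}"
    and d: "\<And>x. x \<in> V \<Longrightarrow> ereal (d x) = dist_to E w \<Gamma> x"
  shows "\<forall>x \<in> V. \<forall>y. (x, y) \<in> E \<longrightarrow>
           (if lies_on_SP E w \<Gamma> y x \<or> lies_on_SP E w \<Gamma> x y
            then \<bar>weighted_gradient w d x y\<bar> = 1
            else \<bar>weighted_gradient w d x y\<bar> < 1)"
proof (intro ballI allI impI)
  fix x y
  assume x: "x \<in> V" and xy: "(x, y) \<in> E"
  have y: "y \<in> V" and yx: "(y, x) \<in> E"
    using xy \<open>E \<subseteq> V \<times> V\<close> E_sym by auto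
  have fin: "finite \<Gamma>"
    using \<open>finite V\<close> \<open>\<Gamma> \<subseteq> V\<close> finite_subset by blast
  have SP_ne: "SP E w \<Gamma> z \<noteq> {}" if "z \<in> V" for z
    using \<open>finite V\<close> \<open>E \<subseteq> V \<times> V\<close> that fin \<open>\<Gamma> \<noteq> {}\<close> connected \<open>\<Gamma> \<subseteq> V\<close> w_nonneg
    by (intro SP_nonempty) auto
  let ?l = "edge_length w x y"
  have l_sym: "edge_length w y x = ?l"
    using w_sym[OF xy] by (simp add: edge_length_def)
  have on_yx: "lies_on_SP E w \<Gamma> y x \<longleftrightarrow> ereal (d x) = ?l + ereal (d y)"
    using lies_on_SP_iff[of \<Gamma> x y E w, OF fin xy SP_ne[OF y] w_nonneg] d x y by simp
  have on_xy: "lies_on_SP E w \<Gamma> x y \<longleftrightarrow> ereal (d y) = ?l + ereal (d x)"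
    using lies_on_SP_iff[of \<Gamma> y x E w, OF fin yx SP_ne[OF x] w_nonneg] d x y l_sym by simp
  \<comment> \<open>By symmetry the triangle inequality holds in both directions of the edge;
    \<open>on_yx\<close> and \<open>on_xy\<close> are its two equality cases.\<close>
  have le: "ereal (d x) \<le> ?l + ereal (d y)" "ereal (d y) \<le> ?l + ereal (d x)"
    using dist_to_triangle[OF fin xy SP_ne[OF y]] dist_to_triangle[OF fin yx SP_ne[OF x]]
      d x y l_sym by simp_all
  show "if lies_on_SP E w \<Gamma> y x \<or> lies_on_SP E w \<Gamma> x y
        then \<bar>weighted_gradient w d x y\<bar> = 1
        else \<bar>weighted_gradient w d x y\<bar> < 1"
  proof (cases "w x y = 0")
    case True
    \<comment> \<open>Here \<open>?l\<close> is infinite while \<open>d\<close> is real-valued, so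
      neither equality case can occur, and the gradient is 0.\<close>
    then show ?thesis
      unfolding on_yx on_xy by (simp add: edge_length_def weighted_gradient_def)
  next
    case False
    define s where "s = sqrt (w x y)"
    have pos: "w x y > 0" "s > 0"
      using False w_nonneg[OF xy] by (simp_all add: s_def)
    have l: "?l = ereal (1 / s)"
      using pos(1) by (simp add: edge_length_eq_ereal s_def)
    \<comment> \<open>The two equality cases are the two signs of \<open>d y - d x\<close>; scaling
      by \<open>s\<close> then turns the bound \<open>1 / s\<close> into 1.\<close>
    have on: "lies_on_SP E w \<Gamma> y x \<or> lies_on_SP E w \<Gamma> x y \<longleftrightarrow> \<bar>d y - d x\<bar> = 1 / s"
      unfolding on_yx on_xy l using pos(2) by (auto simp: abs_if)
    have "\<bar>d y - d x\<bar> \<le> 1 / s"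
      using le unfolding l by auto
    moreover have "\<bar>weighted_gradient w d x y\<bar> = s * \<bar>d y - d x\<bar>"
      using pos by (simp add: weighted_gradient_def s_def abs_mult)
    ultimately show ?thesis
      unfolding on using pos(2) by (auto simp: field_simps)
  qed
qed

end
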